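(* Let $p(z)=a_0z^n+a_1z^{n-1}+\dots+a_n$ be a real polynomial of degree $n\geqslant1$ with $a_0>0$, and let $l=\left[\frac n2\right]$. The polynomial $p$ is self-interlacing of type I if and only if its associated function $\Phi$ is an $R$-function with exactly $l$ poles, all of which are positive, and $\lim_{u\to\pm\infty}\Phi(u)$ is negative whenever $n=2l+1$.
   Context: Here $[\rho]$ denotes the largest integer not exceeding $\rho$. A real polynomial $p$ of degree $n$ is called self-interlacing of type I if all its zeroes $\lambda_1,\dots,\lambda_n$ are real and simple and (suitably numbered) satisfy $0<\lambda_1<-\lambda_2<\lambda_3<\dots<(-1)^{n-1}\lambda_n$. Write $p(z)=p_0(z^2)+zp_1(z^2)$ with real polynomials $p_0,p_1$ (the even and odd parts of $p$). The function associated with $p$ is $\Phi(u)=p_1(u)/p_0(u)$. A rational function $F$ is called an $R$-function if it maps the upper half-plane of the complex plane to the lower half-plane, i.e. $\operatorname{Im}z>0$ implies $\operatorname{Im}F(z)<0$.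
   Formalization: Real constants are also admitted as (degenerate) R-functions; with the strict definition the claim fails for n = 1, e.g. p(z) = z − 1 is self-interlacing of type I but Φ = −1 is not an R-function. For n ≥ 2 nothing changes. *)

theory Defs
  imports "HOL-Complex_Analysis.Complex_Analysis"
begin

abbreviation cpoly :: "real poly \<Rightarrow> complex poly" where
  "cpoly \<equiv> map_poly complex_of_real"

definition self_interlacing_I :: "real poly \<Rightarrow> bool" where
  "self_interlacing_I p \<longleftrightarrow>
     (\<forall>z. poly (cpoly p) z = 0 \<longrightarrow> z \<in> \<real> \<and> order z (cpoly p) = 1) \<and>
     (\<exists>\<zeta>::nat \<Rightarrow> real.
        bij_betw \<zeta> {1..degree p} {x. poly p x = 0} \<and>
        0 < \<zeta> 1 \<and>
        (\<forall>i. 1 \<le> i \<and> i < degree p \<longrightarrow> (-1) ^ (i - 1) * \<zeta> i < (-1) ^ i * \<zeta> (i + 1)))"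

(* The summation bound is generous: coefficients beyond the degree vanish. *)
definition even_part :: "real poly \<Rightarrow> real poly" where
  "even_part p = (\<Sum>i\<le>degree p. monom (coeff p (2 * i)) i)"

definition odd_part :: "real poly \<Rightarrow> real poly" where
  "odd_part p = (\<Sum>i\<le>degree p. monom (coeff p (2 * i + 1)) i)"

lemma even_odd_decomposition:
  "poly p z = poly (even_part p) (z ^ 2) + z * poly (odd_part p) (z ^ 2)"
proof -
  let ?d = "degree p"
  have "poly p z = (\<Sum>i\<le>Suc (2 * ?d). coeff p i * z ^ i)"
    unfolding poly_altdef
    by (intro sum.mono_neutral_left) (auto simp: coeff_eq_0)
  also have "\<dots> = (\<Sum>i\<le>?d. coeff p (2 * i) * z ^ (2 * i) + coeff p (Suc (2 * i)) * z ^ Suc (2 * i))"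
    by (rule sum.in_pairs_0)
  also have "\<dots> = poly (even_part p) (z ^ 2) + z * poly (odd_part p) (z ^ 2)"
    by (simp add: even_part_def odd_part_def poly_sum poly_monom sum.distrib sum_distrib_left
        mult_ac flip: power_mult)
  finally show ?thesis .
qed

(* A rational function is the complex function obtained from a quotient of polynomials by filling
   in its removable singularities, so that common factors of numerator and denominator do not
   matter. At a pole, remove_sings returns the dummy value 0. *)
definition rational_function :: "(complex \<Rightarrow> complex) \<Rightarrow> bool" where
  "rational_function F \<longleftrightarrow>
     (\<exists>P Q. Q \<noteq> 0 \<and> F = remove_sings (\<lambda>z. poly P z / poly Q z))"

definition associated_function :: "real poly \<Rightarrow> complex \<Rightarrow> complex" where
  "associated_function p =
     remove_sings (\<lambda>u. poly (cpoly (odd_part p)) u / poly (cpoly (even_part p)) u)"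

(* The strict inequality also excludes poles in the upper half-plane: there the value of F is the
   dummy 0. *)
definition R_function :: "(complex \<Rightarrow> complex) \<Rightarrow> bool" where
  "R_function F \<longleftrightarrow> rational_function F \<and> (\<forall>z. Im z > 0 \<longrightarrow> Im (F z) < 0)"

(* Real constants do not map the upper half-plane into the open lower one, but they are admitted as
   degenerate R-functions (without poles). They are needed for linear polynomials: z - 1 is
   self-interlacing of type I and its associated function is the constant -1. *)
definition R_function_or_constant :: "(complex \<Rightarrow> complex) \<Rightarrow> bool" where
  "R_function_or_constant F \<longleftrightarrow> R_function F \<or> (\<exists>c::real. F = (\<lambda>_. complex_of_real c))"

end

theory Submission
  imports Defs
begin

text \<open>Write \<open>B\<close> and \<open>A\<close> for the even and odd parts of \<open>p\<close>, so that \<open>p(x) = B(x\<^sup>2) + x A(x\<^sup>2)\<close> and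
  \<open>\<Phi> = A / B\<close>. Both sides of the equivalence are compared with a third condition, which is purely
  real: \<open>B\<close> has \<open>l = n div 2\<close> distinct roots, all positive, the residues \<open>A(w) / B'(w)\<close> at them are
  positive, and the leading coefficient of \<open>B\<close> has the sign of \<open>(-1)^n\<close>.

  For the side of \<open>\<Phi>\<close>: if \<open>B\<close> has simple roots only and \<open>deg A \<le> deg B\<close>, then
  \<open>\<Phi>(u) = L + (\<Sum>w. \<beta>\<^sub>w / (u - w))\<close> with \<open>\<beta>\<^sub>w = A(w) / B'(w)\<close>, and \<open>L\<close> is the quotient of the
  coefficients of \<open>u^(deg B)\<close>. Positive \<open>\<beta>\<^sub>w\<close> make the imaginary part negative on the upper
  half-plane. Conversely, an R-function approached vertically at a pole \<open>w\<close> behaves like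
  \<open>\<beta>\<^sub>w / (\<i> \<epsilon>)\<close>, which forces \<open>\<beta>\<^sub>w \<ge> 0\<close>; and \<open>l\<close> poles exhaust the roots of \<open>B\<close>, because
  \<open>deg B \<le> l\<close>. For \<open>n\<close> even, the leading coefficient of \<open>B\<close> is that of \<open>p\<close>; for \<open>n\<close> odd, that of
  \<open>p\<close> belongs to \<open>A\<close>, and the limit \<open>L\<close> has the sign of the leading coefficient of \<open>B\<close>.

  From residues to roots (\<open>alternating_roots_if_positive_residues\<close>): put \<open>b\<^sub>0 = 0\<close> and let
  \<open>b\<^sub>1 < \<dots> < b\<^sub>l\<close> be the square roots of the roots of \<open>B\<close>. Since \<open>p(\<plusminus>b\<^sub>k) = \<plusminus>b\<^sub>k A(b\<^sub>k\<^sup>2)\<close>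
  alternates in sign with \<open>k\<close>, the intermediate value theorem gives a positive root \<open>x\<^sub>k\<close> and
  a negative root \<open>-y\<^sub>k\<close> of \<open>p\<close> with absolute value in each gap between consecutive \<open>b\<^sub>k\<close>. They satisfy
  \<open>\<Phi>(x\<^sub>k\<^sup>2) = -1 / x\<^sub>k < 0 < 1 / y\<^sub>k = \<Phi>(y\<^sub>k\<^sup>2)\<close>, and \<open>\<Phi>\<close> decreases between its poles, so that
  \<open>y\<^sub>k < x\<^sub>k\<close>: the roots alternate in sign when they are ordered by absolute value.

  From roots to residues (\<open>positive_residues_if_alternating_roots\<close>): the sign of a polynomial with
  simple real roots at a point is given by the number of roots to the right of the point. At a root
  \<open>\<lambda>\<close> of \<open>p\<close> one has \<open>2 B(\<lambda>\<^sup>2) = p(-\<lambda>)\<close>, and counting shows that \<open>B\<close> changes sign between the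
  squares of the roots number \<open>2k - 1\<close> and \<open>2k\<close>. This accounts for all roots of \<open>B\<close>. The same count
  gives the signs of \<open>A(w) = p(\<surd>w) / \<surd>w\<close> and of \<open>B'(w)\<close>.\<close>

section \<open>Polynomials with as many roots as their degree\<close>

lemma poly_eq_prod_roots:
  fixes B :: "'a::field poly"
  assumes "B \<noteq> 0" "card {x. poly B x = 0} = degree B"
  shows "B = smult (lead_coeff B) (\<Prod>w | poly B w = 0. [:- w, 1:])"
proof (rule poly_eqI_degree_lead_coeff[where n = "degree B" and A = "{x. poly B x = 0}"])
  have fin: "finite {x. poly B x = 0}"
    using assms(1) by (rule poly_roots_finite)
  have deg: "degree (\<Prod>w | poly B w = 0. [:- w, 1:]) = degree B"
    using assms(2) by (subst degree_prod_sum_eq) auto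
  show "degree (smult (lead_coeff B) (\<Prod>w | poly B w = 0. [:- w, 1:])) \<le> degree B"
    using deg by simp
  have "lead_coeff (\<Prod>w | poly B w = 0. [:- w, 1:]) = 1"
    by (simp add: lead_coeff_prod)
  then show "coeff B (degree B) = coeff (smult (lead_coeff B) (\<Prod>w | poly B w = 0. [:- w, 1:])) (degree B)"
    using deg by simp
  show "poly B z = poly (smult (lead_coeff B) (\<Prod>w | poly B w = 0. [:- w, 1:])) z"
    if "z \<in> {x. poly B x = 0}" for z
    using that fin by (auto simp: poly_prod)
qed (use assms in auto)

lemma poly_as_prod_roots:
  fixes B :: "'a::field poly"
  assumes "B \<noteq> 0" "card {x. poly B x = 0} = degree B"
  shows "poly B x = lead_coeff B * (\<Prod>w | poly B w = 0. x - w)"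
  by (subst poly_eq_prod_roots[OF assms]) (simp add: poly_prod)

lemma poly_pderiv_at_root:
  fixes B :: "'a::field poly"
  assumes "B \<noteq> 0" "card {x. poly B x = 0} = degree B" and w: "poly B w = 0"
  shows "poly (pderiv B) w = lead_coeff B * (\<Prod>v\<in>{x. poly B x = 0} - {w}. w - v)"
proof -
  define q where "q = (\<Prod>v\<in>{x. poly B x = 0} - {w}. [:- v, 1:])"
  have "finite {x. poly B x = 0}"
    using assms(1) by (rule poly_roots_finite)
  then have "(\<Prod>v | poly B v = 0. [:- v, 1:]) = [:- w, 1:] * q"
    unfolding q_def using w by (intro prod.remove) auto
  then have "B = smult (lead_coeff B) ([:- w, 1:] * q)"
    using poly_eq_prod_roots[OF assms(1,2)] by metis
  then have "pderiv B = smult (lead_coeff B) (pderiv ([:- w, 1:] * q))"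
    by (metis pderiv_smult)
  then have "poly (pderiv B) w = lead_coeff B * poly q w"
    by (simp only: pderiv_mult) (simp add: pderiv_pCons)
  then show ?thesis
    by (simp add: q_def poly_prod)
qed

text \<open>Lagrange interpolation: both sides, multiplied by \<open>B\<close>, are polynomials of degree at most
  \<open>deg B\<close> that have the same coefficient there and agree at the \<open>deg B\<close> roots of \<open>B\<close>. The
  first summand is \<open>0\<close> when \<open>deg A < deg B\<close>.\<close>

lemma partial_fractions:
  fixes A B :: "'a::field poly"
  assumes "B \<noteq> 0" "card {x. poly B x = 0} = degree B" "degree A \<le> degree B" "poly B u \<noteq> 0"
  shows "poly A u / poly B u = coeff A (degree B) / lead_coeff B +
    (\<Sum>w | poly B w = 0. poly A w / poly (pderiv B) w / (u - w))"
proof -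
  define R where "R = {x. poly B x = 0}"
  define q where "q w = smult (lead_coeff B) (\<Prod>v\<in>R - {w}. [:- v, 1:])" for w
  define r where "r w = poly A w / poly (pderiv B) w" for w
  define L where "L = coeff A (degree B) / lead_coeff B"
  have fin: "finite R"
    unfolding R_def using assms(1) by (rule poly_roots_finite)
  have B': "poly (pderiv B) w \<noteq> 0" "poly (q w) w = poly (pderiv B) w" if "w \<in> R" for w
    using poly_pderiv_at_root[OF assms(1,2)] that fin assms(1)
    by (auto simp: R_def q_def poly_prod)
  have q_other: "poly (q w) v = 0" if "v \<in> R" "v \<noteq> w" for v w
    using that fin by (auto simp: q_def poly_prod)
  have deg_q: "degree (q w) < degree B" if "w \<in> R" for w
  proof -
    have "degree (q w) = card (R - {w})"
      using assms(1) by (simp add: q_def degree_prod_sum_eq)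
    then show ?thesis
      using that fin assms(2) by (metis R_def card_Diff1_less)
  qed
  \<comment> \<open>The interpolation formula; \<open>q w\<close> is \<open>B\<close> without the factor \<open>X - w\<close>.\<close>
  have *: "A = smult L B + (\<Sum>w\<in>R. smult (r w) (q w))"
  proof (rule poly_eqI_degree_lead_coeff[where n = "degree B" and A = R])
    show "coeff A (degree B) = coeff (smult L B + (\<Sum>w\<in>R. smult (r w) (q w))) (degree B)"
      using deg_q assms(1) by (simp add: coeff_sum coeff_eq_0 L_def)
    have "degree (\<Sum>w\<in>R. smult (r w) (q w)) \<le> degree B"
      using deg_q by (intro degree_sum_le fin)
        (meson degree_smult_le le_trans less_imp_le)
    then show "degree (smult L B + (\<Sum>w\<in>R. smult (r w) (q w))) \<le> degree B"
      by (intro degree_add_le) auto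
    fix v assume v: "v \<in> R"
    have "(\<Sum>w\<in>R. r w * poly (q w) v) = (\<Sum>w\<in>R. if w = v then poly A v else 0)"
      using B' q_other v by (intro sum.cong) (auto simp: r_def)
    then show "poly A v = poly (smult L B + (\<Sum>w\<in>R. smult (r w) (q w))) v"
      using v fin by (simp add: poly_sum) (simp add: R_def)
  qed (use assms in \<open>auto simp: R_def\<close>)
  have qu: "poly (q w) u = poly B u / (u - w)" if "w \<in> R" for w
  proof -
    have "poly B u = (u - w) * poly (q w) u"
      using that fin unfolding poly_as_prod_roots[OF assms(1,2), of u] R_def[symmetric]
      by (simp add: q_def poly_prod prod.remove[where x = w])
    then show ?thesis using assms(4) by (metis mult_zero_left nonzero_mult_div_cancel_left)
  qed
  have "poly A u = L * poly B u + (\<Sum>w\<in>R. r w * poly (q w) u)"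
    by (subst *) (simp add: poly_sum)
  also have "\<dots> = poly B u * (L + (\<Sum>w\<in>R. r w / (u - w)))"
    by (simp add: qu sum_distrib_left distrib_left mult_ac)
  finally show ?thesis
    using assms(4) by (simp add: L_def R_def r_def)
qed

text \<open>The orders add up to at most the degree, and each of them is at least \<open>1\<close>.\<close>

lemma order_eq_1_if_split:
  fixes B :: "'a::field poly"
  assumes "B \<noteq> 0" "card {x. poly B x = 0} = degree B" "poly B z = 0"
  shows "order z B = 1"
proof -
  have fin: "finite {x. poly B x = 0}"
    using assms(1) by (rule poly_roots_finite)
  have ge: "1 \<le> order x B" if "poly B x = 0" for x
    using that assms(1) order_gt_0_iff[of B x] by simp
  have "(\<Sum>x | poly B x = 0. order x B) \<le> (\<Sum>x | poly B x = 0. 1)"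
    using sum_order_le_degree[OF assms(1)] assms(2) by simp
  then have "order z B \<le> 1"
    using sum_strict_mono_ex1[OF fin, of "\<lambda>_. 1" "\<lambda>x. order x B"] ge assms(3)
    by (metis (mono_tags, lifting) mem_Collect_eq not_le)
  then show ?thesis
    using ge[OF assms(3)] by simp
qed

section \<open>Signs of real polynomials with simple real roots\<close>

lemma prod_sign:
  fixes g :: "'a \<Rightarrow> real"
  assumes "finite S" "\<And>s. s \<in> S \<Longrightarrow> g s \<noteq> 0"
  shows "0 < (-1) ^ card {s \<in> S. g s < 0} * prod g S"
  using assms
proof (induction S)
  case (insert s S)
  have "{t \<in> insert s S. g t < 0} = (if g s < 0 then insert s {t \<in> S. g t < 0} else {t \<in> S. g t < 0})"
    by auto
  then show ?case
    using insert by (cases "g s < 0"; force simp: zero_less_mult_iff mult_less_0_iff not_less)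
qed simp

text \<open>Only the roots to the right of \<open>x\<close> contribute a negative factor to \<open>\<Prod>w. x - w\<close>.\<close>

lemma poly_sign:
  fixes B :: "real poly"
  assumes "B \<noteq> 0" "card {x. poly B x = 0} = degree B" "poly B x \<noteq> 0"
  shows "0 < lead_coeff B * (-1) ^ card {w. poly B w = 0 \<and> x < w} * poly B x"
proof -
  have "0 < (-1) ^ card {w \<in> {w. poly B w = 0}. x - w < 0} * (\<Prod>w | poly B w = 0. x - w)"
    using assms by (intro prod_sign poly_roots_finite) auto
  moreover have "0 < (lead_coeff B)\<^sup>2"
    using assms(1) by simp
  ultimately have "0 < (lead_coeff B)\<^sup>2 *
      ((-1) ^ card {w \<in> {w. poly B w = 0}. x - w < 0} * (\<Prod>w | poly B w = 0. x - w))"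
    by (rule mult_pos_pos[rotated])
  then show ?thesis
    by (simp add: poly_as_prod_roots[OF assms(1,2), of x] power2_eq_square mult_ac)
qed

text \<open>At a root \<open>x\<close> the derivative is the product of the remaining factors, so that the same count
  applies.\<close>

lemma pderiv_sign:
  fixes B :: "real poly"
  assumes "B \<noteq> 0" "card {x. poly B x = 0} = degree B" "poly B x = 0"
  shows "0 < lead_coeff B * (-1) ^ card {w. poly B w = 0 \<and> x < w} * poly (pderiv B) x"
proof -
  have "{w \<in> {w. poly B w = 0} - {x}. x - w < 0} = {w. poly B w = 0 \<and> x < w}"
    by auto
  moreover have "0 < (lead_coeff B)\<^sup>2"
    using assms(1) by simp
  moreover have "0 < (-1) ^ card {w \<in> {w. poly B w = 0} - {x}. x - w < 0} *
      (\<Prod>w\<in>{w. poly B w = 0} - {x}. x - w)"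
    using assms by (intro prod_sign finite_Diff poly_roots_finite) auto
  ultimately have "0 < (lead_coeff B)\<^sup>2 * ((-1) ^ card {w. poly B w = 0 \<and> x < w} *
      (\<Prod>w\<in>{w. poly B w = 0} - {x}. x - w))"
    by (simp only: mult_pos_pos)
  then show ?thesis
    by (simp add: poly_pderiv_at_root[OF assms] power2_eq_square mult_ac)
qed

section \<open>Real polynomials as complex polynomials\<close>

lemma poly_cpoly_of_real: "poly (cpoly p) (of_real x) = of_real (poly p x)"
  by (induction p) (auto simp: map_poly_pCons)

lemma degree_cpoly: "degree (cpoly p) = degree p"
  by (simp add: degree_map_poly)

lemma cpoly_eq_0_iff: "cpoly p = 0 \<longleftrightarrow> p = 0"
  by (simp add: map_poly_eq_0_iff)

lemma pderiv_cpoly: "pderiv (cpoly p) = cpoly (pderiv p)"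
  by (rule poly_eqI) (simp add: coeff_pderiv coeff_map_poly)

lemma cpoly_roots_split:
  assumes "p \<noteq> 0" "card {x. poly p x = 0} = degree p"
  shows "{z. poly (cpoly p) z = 0} = of_real ` {x. poly p x = 0}"
    and "card {z. poly (cpoly p) z = 0} = degree (cpoly p)"
proof -
  have sub: "of_real ` {x. poly p x = 0} \<subseteq> {z. poly (cpoly p) z = 0}"
    by (auto simp: poly_cpoly_of_real)
  have fin: "finite {z. poly (cpoly p) z = 0}"
    using assms by (intro poly_roots_finite) (simp add: cpoly_eq_0_iff)
  have "card (complex_of_real ` {x. poly p x = 0}) = degree p"
    using assms by (subst card_image) (auto intro: inj_onI)
  moreover have "card {z. poly (cpoly p) z = 0} \<le> degree p"
    using card_poly_roots_bound[of "cpoly p"] assms by (simp add: cpoly_eq_0_iff degree_cpoly)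
  ultimately show eq: "{z. poly (cpoly p) z = 0} = of_real ` {x. poly p x = 0}"
    using card_seteq[OF fin sub] by simp
  show "card {z. poly (cpoly p) z = 0} = degree (cpoly p)"
    using assms unfolding eq by (subst card_image) (auto intro: inj_onI simp: degree_cpoly)
qed

section \<open>The quotient as a function with poles\<close>

text \<open>The quotient \<open>A / B\<close> has only simple positive poles with positive residues and a finite limit at
  infinity. The residue at \<open>w\<close> is \<open>A(w) / B'(w)\<close>; a positive product says the same and includes
  \<open>B'(w) \<noteq> 0\<close>. That all complex roots of \<open>B\<close> are real and simple is expressed by the number
  of its real roots.\<close>

definition positive_residues :: "real poly \<Rightarrow> real poly \<Rightarrow> bool" where
  "positive_residues A B \<longleftrightarrow>
     B \<noteq> 0 \<and> card {x. poly B x = 0} = degree B \<and> degree A \<le> degree B \<and>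
     (\<forall>w. poly B w = 0 \<longrightarrow> 0 < w \<and> 0 < poly A w * poly (pderiv B) w)"

abbreviation quotient_function :: "real poly \<Rightarrow> real poly \<Rightarrow> complex \<Rightarrow> complex" where
  "quotient_function A B \<equiv> remove_sings (\<lambda>u. poly (cpoly A) u / poly (cpoly B) u)"

lemma tendsto_poly_at: "poly p \<midarrow>u\<rightarrow> poly p u" for p :: "complex poly"
  by (rule isContD) simp

lemma quotient_function_eq:
  assumes "poly (cpoly B) u \<noteq> 0"
  shows "quotient_function A B u = poly (cpoly A) u / poly (cpoly B) u"
    and "quotient_function A B \<midarrow>u\<rightarrow> quotient_function A B u"
proof -
  have lim: "(\<lambda>u. poly (cpoly A) u / poly (cpoly B) u) \<midarrow>u\<rightarrow> poly (cpoly A) u / poly (cpoly B) u"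
    using assms by (intro tendsto_divide tendsto_poly_at)
  then show eq: "quotient_function A B u = poly (cpoly A) u / poly (cpoly B) u"
    by (rule remove_sings_eqI)
  have "\<forall>\<^sub>F w in at u. poly (cpoly B) w \<noteq> 0"
    using tendsto_imp_eventually_ne[OF tendsto_poly_at assms] .
  then have "\<forall>\<^sub>F w in at u. quotient_function A B w = poly (cpoly A) w / poly (cpoly B) w"
    by eventually_elim (rule remove_sings_eqI, intro tendsto_divide tendsto_poly_at)
  then show "quotient_function A B \<midarrow>u\<rightarrow> quotient_function A B u"
    unfolding eq using lim by (subst tendsto_cong)
qed

lemma eventually_quotient_function_eq:
  assumes "B \<noteq> 0"
  shows "\<forall>\<^sub>F w in at u. poly (cpoly B) w \<noteq> 0 \<and>
    quotient_function A B w = poly (cpoly A) w / poly (cpoly B) w"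
proof -
  have "finite {z. poly (cpoly B) z = 0}"
    using assms by (intro poly_roots_finite) (simp add: cpoly_eq_0_iff)
  then have "\<forall>\<^sub>F w in at u. poly (cpoly B) w \<noteq> 0"
    using islimpt_finite islimpt_iff_eventually[of u "{z. poly (cpoly B) z = 0}"] by auto
  then show ?thesis
    by eventually_elim (auto intro: quotient_function_eq(1))
qed

lemma pole_imp_root:
  assumes "is_pole (quotient_function A B) u"
  shows "poly (cpoly B) u = 0"
proof (rule ccontr)
  assume "poly (cpoly B) u \<noteq> 0"
  then show False
    using quotient_function_eq(2)[of B u A] assms
    by (auto simp: is_pole_def dest: not_tendsto_and_filterlim_at_infinity[rotated])
qed

lemma root_imp_pole:
  assumes "B \<noteq> 0" "poly (cpoly B) u = 0" "poly (cpoly A) u \<noteq> 0"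
  shows "is_pole (quotient_function A B) u"
proof -
  have "filterlim (poly (cpoly B)) (at 0) (at u)"
    using tendsto_poly_at[of "cpoly B" u] eventually_quotient_function_eq[OF assms(1), of A u] assms(2)
    by (auto simp: filterlim_at elim: eventually_mono)
  then have "is_pole (\<lambda>u. poly (cpoly A) u / poly (cpoly B) u) u"
    using assms(3) by (intro is_pole_divide poly_isCont)
  then show ?thesis
    by (rule is_pole_transform)
      (use eventually_quotient_function_eq[OF assms(1), of A u] in \<open>auto elim: eventually_mono\<close>)
qed

text \<open>At a simple root of \<open>B\<close>, the factor \<open>u - w\<close> cancels; if \<open>A\<close> vanishes there as well,
  the singularity is removable.\<close>

lemma quotient_function_residue:
  assumes "poly (cpoly B) w = 0" "poly (cpoly (pderiv B)) w \<noteq> 0"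
  shows "(\<lambda>u. (u - w) * quotient_function A B u) \<midarrow>w\<rightarrow>
      poly (cpoly A) w / poly (cpoly (pderiv B)) w"
    and "poly (cpoly A) w = 0 \<Longrightarrow> \<not> is_pole (quotient_function A B) w"
proof -
  have B0: "B \<noteq> 0"
    using assms(2) by auto
  obtain q where q: "cpoly B = [:- w, 1:] * q"
    using assms(1) by (metis dvdE poly_eq_0_iff_dvd)
  have qB: "poly (cpoly B) u = (u - w) * poly q u" for u
    by (simp add: q algebra_simps)
  have "poly (pderiv (cpoly B)) w = poly q w"
    by (simp only: q pderiv_mult) (simp add: pderiv_pCons)
  then have qw: "poly q w = poly (cpoly (pderiv B)) w"
    by (simp add: pderiv_cpoly)
  then have lim: "(\<lambda>u. poly a u / poly q u) \<midarrow>w\<rightarrow> poly a w / poly (cpoly (pderiv B)) w" for a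
    using assms(2) tendsto_divide[OF tendsto_poly_at[of a w] tendsto_poly_at[of q w]] by simp
  have "\<forall>\<^sub>F u in at w. poly (cpoly A) u / poly q u = (u - w) * quotient_function A B u"
    using eventually_quotient_function_eq[OF B0, of A w] by eventually_elim (auto simp: qB)
  then show "(\<lambda>u. (u - w) * quotient_function A B u) \<midarrow>w\<rightarrow>
      poly (cpoly A) w / poly (cpoly (pderiv B)) w"
    by (rule Lim_transform_eventually[OF lim])
  show "\<not> is_pole (quotient_function A B) w" if "poly (cpoly A) w = 0"
  proof -
    obtain a where a: "cpoly A = [:- w, 1:] * a"
      using \<open>poly (cpoly A) w = 0\<close> by (metis dvdE poly_eq_0_iff_dvd)
    have aA: "poly (cpoly A) u = (u - w) * poly a u" for u
      by (simp add: a algebra_simps)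
    have "\<forall>\<^sub>F u in at w. poly a u / poly q u = quotient_function A B u"
      using eventually_quotient_function_eq[OF B0, of A w] by eventually_elim (auto simp: qB aA)
    then have "\<exists>c. quotient_function A B \<midarrow>w\<rightarrow> c"
      by (intro exI) (rule Lim_transform_eventually[OF lim[of a]])
    then show ?thesis
      by (auto simp: is_pole_def dest: not_tendsto_and_filterlim_at_infinity[rotated])
  qed
qed

section \<open>Positive residues and the half-plane condition\<close>

text \<open>Approach \<open>w\<close> along \<open>u = w + \<i> e\<close> with \<open>e > 0\<close>: the real part of \<open>\<i> e F(u)\<close> is \<open>-e Im (F u)\<close>,
  which is positive.\<close>

lemma residue_nonneg_if_Im_neg:
  assumes Im: "\<And>z. Im z > 0 \<Longrightarrow> Im (F z) < 0"
    and lim: "(\<lambda>u. (u - of_real w) * F u) \<midarrow>of_real w\<rightarrow> of_real r"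
  shows "0 \<le> r"
proof -
  have "filterlim (\<lambda>e. of_real w + \<i> * of_real e) (at (of_real w)) (at_right (0::real))"
  proof (rule filterlim_atI)
    show "((\<lambda>e. of_real w + \<i> * of_real e) \<longlongrightarrow> complex_of_real w) (at_right 0)"
      by (auto intro!: tendsto_eq_intros)
    show "\<forall>\<^sub>F e in at_right (0::real). of_real w + \<i> * of_real e \<noteq> complex_of_real w"
      using eventually_at_right_less[of "0::real"] by eventually_elim auto
  qed
  from filterlim_compose[OF lim this]
  have "((\<lambda>e. \<i> * of_real e * F (of_real w + \<i> * of_real e)) \<longlongrightarrow> of_real r) (at_right (0::real))"
    by simp
  then have "((\<lambda>e. Re (\<i> * of_real e * F (of_real w + \<i> * of_real e))) \<longlongrightarrow> r) (at_right (0::real))"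
    using tendsto_Re by force
  moreover have "\<forall>\<^sub>F e in at_right (0::real). 0 \<le> Re (\<i> * of_real e * F (of_real w + \<i> * of_real e))"
    using eventually_at_right_less[of "0::real"]
  proof eventually_elim
    case (elim e)
    then have "Im (F (of_real w + \<i> * of_real e)) < 0"
      by (intro Im) simp
    then show ?case
      using elim by (simp add: mult_pos_neg less_imp_le)
  qed
  ultimately show ?thesis
    by (intro tendsto_lowerbound) auto
qed

lemma quotient_function_partial_fractions:
  assumes "positive_residues A B" "poly (cpoly B) u \<noteq> 0"
  shows "quotient_function A B u = of_real (coeff A (degree B) / lead_coeff B) +
    (\<Sum>w | poly B w = 0. of_real (poly A w / poly (pderiv B) w) / (u - of_real w))"
proof -
  have B: "B \<noteq> 0" "card {x. poly B x = 0} = degree B" "degree A \<le> degree B"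
    using assms(1) by (auto simp: positive_residues_def)
  have "quotient_function A B u = poly (cpoly A) u / poly (cpoly B) u"
    using assms(2) by (rule quotient_function_eq)
  also have "\<dots> = coeff (cpoly A) (degree (cpoly B)) / lead_coeff (cpoly B) +
    (\<Sum>w | poly (cpoly B) w = 0. poly (cpoly A) w / poly (pderiv (cpoly B)) w / (u - w))"
    using B cpoly_roots_split[OF B(1,2)] assms(2)
    by (intro partial_fractions) (auto simp: degree_cpoly cpoly_eq_0_iff)
  also have "(\<Sum>w | poly (cpoly B) w = 0. poly (cpoly A) w / poly (pderiv (cpoly B)) w / (u - w)) =
    (\<Sum>w | poly B w = 0. of_real (poly A w / poly (pderiv B) w) / (u - of_real w))"
    unfolding cpoly_roots_split(1)[OF B(1,2)]
    by (subst sum.reindex) (auto intro: inj_onI simp: pderiv_cpoly poly_cpoly_of_real)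
  finally show ?thesis
    by (simp add: degree_cpoly coeff_map_poly)
qed

lemma positive_residues_coeff_pos:
  assumes "positive_residues A B" "poly B w = 0"
  shows "0 < poly A w / poly (pderiv B) w"
  using assms by (auto simp: positive_residues_def zero_less_mult_iff zero_less_divide_iff)

text \<open>Every term \<open>\<beta> / (z - w)\<close> of the partial fraction expansion with \<open>\<beta> > 0\<close> and real \<open>w\<close> has
  negative imaginary part, and the constant term is real. Without poles the quotient is a real
  constant, which explains the assumption on the degree.\<close>

lemma quotient_function_Im_neg:
  assumes AB: "positive_residues A B" and "degree B > 0" "Im z > 0"
  shows "Im (quotient_function A B z) < 0"
proof -
  have B: "B \<noteq> 0" "card {x. poly B x = 0} = degree B"
    using AB by (auto simp: positive_residues_def)
  have "z \<notin> {z. poly (cpoly B) z = 0}"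
    unfolding cpoly_roots_split(1)[OF B] using assms(3) by auto
  then have "Im (quotient_function A B z) =
      (\<Sum>w | poly B w = 0. Im (of_real (poly A w / poly (pderiv B) w) / (z - of_real w)))"
    by (subst quotient_function_partial_fractions[OF AB]) (auto simp del: of_real_divide)
  also have "\<dots> < (\<Sum>w | poly B w = 0. 0)"
  proof (rule sum_strict_mono)
    fix w assume "w \<in> {w. poly B w = 0}"
    then have pos: "0 < poly A w / poly (pderiv B) w"
      using positive_residues_coeff_pos[OF AB] by auto
    have "Im (of_real (poly A w / poly (pderiv B) w) / (z - of_real w)) =
      - (poly A w / poly (pderiv B) w * Im z) / ((Re z - w)\<^sup>2 + (Im z)\<^sup>2)"
      by (simp add: Im_divide del: of_real_divide)
    also have "\<dots> < 0"
      using mult_pos_pos[OF pos assms(3)] assms(3)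
      by (intro divide_neg_pos) (auto simp del: times_divide_eq_left intro: add_nonneg_pos)
    finally show "Im (of_real (poly A w / poly (pderiv B) w) / (z - of_real w)) < 0" .
  next
    show "finite {w. poly B w = 0}" using B(1) by (rule poly_roots_finite)
    show "{w. poly B w = 0} \<noteq> {}" using B assms(2) by (metis card.empty less_irrefl)
  qed
  finally show ?thesis by simp
qed

lemma quotient_function_limit:
  assumes AB: "positive_residues A B"
  shows "((\<lambda>x. quotient_function A B (of_real x)) \<longlongrightarrow> of_real (coeff A (degree B) / lead_coeff B))
    at_infinity"
proof -
  have "finite {x. poly B x = 0}"
    using AB by (intro poly_roots_finite) (auto simp: positive_residues_def)
  then obtain b where b: "\<And>x. poly B x = 0 \<Longrightarrow> norm x \<le> b"
    using finite_imp_bounded[THEN bounded_iff[THEN iffD1]] by blast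
  have "\<forall>\<^sub>F x in at_infinity. poly B x \<noteq> 0"
    by (rule eventually_at_infinityI[of "b + 1"]) (use b in force)
  then have ev: "\<forall>\<^sub>F x in at_infinity. of_real (coeff A (degree B) / lead_coeff B) +
      (\<Sum>w | poly B w = 0. of_real (poly A w / poly (pderiv B) w) / (of_real x - of_real w))
      = quotient_function A B (of_real x)"
    by eventually_elim
      (subst quotient_function_partial_fractions[OF AB], auto simp: poly_cpoly_of_real)
  have "((\<lambda>x. of_real (poly A w / poly (pderiv B) w) / (of_real x - complex_of_real w)) \<longlongrightarrow> 0)
      at_infinity" for w
  proof (rule tendsto_divide_0[OF tendsto_const])
    have "filterlim (\<lambda>x::real. complex_of_real x) at_infinity at_infinity"
      unfolding filterlim_at_infinity_conv_norm_at_top norm_of_real real_norm_def[symmetric]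
      by (rule filterlim_norm_at_top)
    then show "filterlim (\<lambda>x. of_real x - complex_of_real w) at_infinity at_infinity"
      using tendsto_add_filterlim_at_infinity'[OF _ tendsto_const[of "- complex_of_real w"]] by simp
  qed
  then have "((\<lambda>x. of_real (coeff A (degree B) / lead_coeff B) +
      (\<Sum>w | poly B w = 0. of_real (poly A w / poly (pderiv B) w) / (of_real x - complex_of_real w)))
      \<longlongrightarrow> of_real (coeff A (degree B) / lead_coeff B) + (\<Sum>w | poly B w = 0. 0)) at_infinity"
    by (intro tendsto_add tendsto_const tendsto_sum)
  then show ?thesis
    using ev by (simp add: tendsto_cong)
qed

lemma quotient_function_poles:
  assumes AB: "positive_residues A B"
  shows "{u. is_pole (quotient_function A B) u} = of_real ` {w. poly B w = 0}"
proof -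
  have B: "B \<noteq> 0" "card {x. poly B x = 0} = degree B"
    using AB by (auto simp: positive_residues_def)
  have "is_pole (quotient_function A B) (of_real w)" if "poly B w = 0" for w
    using positive_residues_coeff_pos[OF AB that] that B(1)
    by (intro root_imp_pole) (auto simp: poly_cpoly_of_real)
  then show ?thesis
    using pole_imp_root[of A B] cpoly_roots_split(1)[OF B] by blast
qed

text \<open>The poles are roots of \<open>B\<close>, and there are as many of them as the degree of \<open>B\<close> permits. Hence
  all roots of \<open>B\<close> are simple, and none of them is a root of \<open>A\<close>, as it would then not be a
  pole. So the residues are nonzero, and the half-plane condition decides their sign.\<close>

lemma positive_residues_if_R_function:
  assumes "B \<noteq> 0" "degree A \<le> degree B"
    and Im: "\<And>z. Im z > 0 \<Longrightarrow> degree B > 0 \<Longrightarrow> Im (quotient_function A B z) < 0"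
    and card: "card {u. is_pole (quotient_function A B) u} = degree B"
    and pos: "\<And>u. is_pole (quotient_function A B) u \<Longrightarrow> u \<in> \<real> \<and> Re u > 0"
  shows "positive_residues A B"
proof -
  have cB: "cpoly B \<noteq> 0"
    using assms(1) by (simp add: cpoly_eq_0_iff)
  have "card {u. poly (cpoly B) u = 0} \<le> card {u. is_pole (quotient_function A B) u}"
    using card card_poly_roots_bound[OF cB] by (simp add: degree_cpoly)
  then have poles: "{u. is_pole (quotient_function A B) u} = {u. poly (cpoly B) u = 0}"
    by (intro card_seteq poly_roots_finite cB) (auto dest: pole_imp_root)
  have roots: "{u. poly (cpoly B) u = 0} = of_real ` {w. poly B w = 0}"
  proof (intro subset_antisym subsetI)
    fix u assume u: "u \<in> {u. poly (cpoly B) u = 0}"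
    then have "u = of_real (Re u)"
      using pos poles by (metis Reals_cases Re_complex_of_real mem_Collect_eq)
    with u show "u \<in> of_real ` {w. poly B w = 0}"
      by (metis (mono_tags) imageI mem_Collect_eq of_real_eq_0_iff poly_cpoly_of_real)
  qed (auto simp: poly_cpoly_of_real)
  have "card {w. poly B w = 0} = card (complex_of_real ` {w. poly B w = 0})"
    by (subst card_image) (auto intro: inj_onI)
  then have split: "card {w. poly B w = 0} = degree B"
    using card poles roots by simp
  have "0 < w \<and> 0 < poly A w * poly (pderiv B) w" if w: "poly B w = 0" for w
  proof -
    have pole: "is_pole (quotient_function A B) (of_real w)"
      using w poles roots by auto
    have "degree B > 0"
      using w assms(1) by (metis degree_eq_zeroE gr0I pCons_0_0 poly_0 poly_pCons mult_zero_right add_0_right)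
    have B': "poly (pderiv B) w \<noteq> 0"
      using poly_pderiv_at_root[OF assms(1) split w] assms(1) poly_roots_finite[OF assms(1)]
      by auto
    then have "poly A w \<noteq> 0"
      using quotient_function_residue(2)[of B "of_real w" A] pole w by (auto simp: poly_cpoly_of_real)
    moreover have "(\<lambda>u. (u - of_real w) * quotient_function A B u) \<midarrow>of_real w\<rightarrow>
        of_real (poly A w / poly (pderiv B) w)"
      using quotient_function_residue(1)[of B "of_real w" A] B' w by (simp add: poly_cpoly_of_real)
    then have "0 \<le> poly A w / poly (pderiv B) w"
      using Im \<open>degree B > 0\<close> by (intro residue_nonneg_if_Im_neg)
    ultimately show ?thesis
      using pos[OF pole] B' by (auto simp: zero_le_divide_iff zero_less_mult_iff)
  qed
  then show ?thesis
    using assms(1,2) split by (auto simp: positive_residues_def)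
qed

section \<open>Coefficients of the even and odd parts\<close>

lemma coeff_even_part: "coeff (even_part p) i = coeff p (2 * i)"
  by (auto simp: even_part_def coeff_sum coeff_monom coeff_eq_0)

lemma coeff_odd_part: "coeff (odd_part p) i = coeff p (2 * i + 1)"
  by (auto simp: odd_part_def coeff_sum coeff_monom coeff_eq_0)

lemma degree_even_part: "degree (even_part p) \<le> degree p div 2"
  by (rule degree_le) (auto simp: coeff_even_part intro!: coeff_eq_0)

lemma degree_odd_part: "degree (odd_part p) \<le> degree p div 2"
  by (rule degree_le) (auto simp: coeff_odd_part intro!: coeff_eq_0)

section \<open>Increasing enumerations\<close>

lemma finite_set_increasing_enum:
  fixes S :: "real set"
  assumes "finite S"
  obtains e where "S = e ` {1..card S}" "\<And>i j. 1 \<le> i \<Longrightarrow> i < j \<Longrightarrow> j \<le> card S \<Longrightarrow> e i < e j"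
proof
  let ?e = "\<lambda>i. sorted_list_of_set S ! (i - 1)"
  have "S = set (sorted_list_of_set S)"
    using assms by simp
  also have "\<dots> = (!) (sorted_list_of_set S) ` {..<card S}"
    using assms by (auto simp: set_conv_nth)
  also have "{..<card S} = (\<lambda>i. i - 1) ` {1..card S}"
    by (auto simp: image_iff intro!: bexI[of _ "Suc _"])
  finally show "S = ?e ` {1..card S}"
    by (simp add: image_image)
  show "?e i < ?e j" if "1 \<le> i" "i < j" "j \<le> card S" for i j
    using that by (intro sorted_wrt_nth_less[OF strict_sorted_list_of_set]) auto
qed

lemma increasing_if_step:
  fixes r :: "nat \<Rightarrow> real"
  assumes "\<And>i. 1 \<le> i \<Longrightarrow> i < n \<Longrightarrow> r i < r (i + 1)" "1 \<le> i" "i < j" "j \<le> n"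
  shows "r i < r j"
  using assms(3,4)
proof (induction j)
  case (Suc j)
  then show ?case
    using assms(1)[of j] assms(2) by (cases "i = j") auto
qed simp

lemma card_above_increasing_enum:
  fixes e :: "nat \<Rightarrow> real"
  assumes inc: "\<And>i j. 1 \<le> i \<Longrightarrow> i < j \<Longrightarrow> j \<le> l \<Longrightarrow> e i < e j" and k: "1 \<le> k" "k \<le> l"
  shows "card {w \<in> e ` {1..l}. e k < w} = l - k"
proof -
  have iff: "e k < e i \<longleftrightarrow> k < i" if "i \<in> {1..l}" for i
    using inc[of k i] inc[of i k] k that by (cases i k rule: linorder_cases) auto
  have "{w \<in> e ` {1..l}. e k < w} = e ` {i \<in> {1..l}. e k < e i}"
    by blast
  also have "{i \<in> {1..l}. e k < e i} = {k<..l}"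
    using iff k by auto
  finally have "{w \<in> e ` {1..l}. e k < w} = e ` {k<..l}" .
  moreover have "inj_on e {k<..l}"
  proof (rule linorder_inj_onI)
    show "e i \<noteq> e j" if "i < j" "i \<in> {k<..l}" "j \<in> {k<..l}" for i j
      using inc[of i j] that by simp
  qed auto
  ultimately show ?thesis
    by (simp add: card_image)
qed

section \<open>Self-interlacing as alternation in sign\<close>

text \<open>The absolute values of the roots, in increasing order. In terms of the numbering \<open>\<zeta>\<close> in the
  definition of self-interlacing, \<open>r i = (-1)^(i - 1) \<zeta> i\<close>.\<close>

definition alternating_roots :: "real poly \<Rightarrow> (nat \<Rightarrow> real) \<Rightarrow> bool" where
  "alternating_roots p r \<longleftrightarrow> 0 < r 1 \<and>
     (\<forall>i j. 1 \<le> i \<longrightarrow> i < j \<longrightarrow> j \<le> degree p \<longrightarrow> r i < r j) \<and>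
     (\<forall>i. 1 \<le> i \<longrightarrow> i \<le> degree p \<longrightarrow> poly p ((-1) ^ (i - 1) * r i) = 0)"

text \<open>The signed values are distinct because their absolute values are, and \<open>p\<close> has no more than
  \<open>deg p\<close> roots.\<close>

lemma alternating_roots_all:
  assumes "alternating_roots p r" "degree p \<ge> 1"
  defines "\<zeta> \<equiv> \<lambda>i. (-1) ^ (i - 1) * r i"
  shows "bij_betw \<zeta> {1..degree p} {x. poly p x = 0}" "card {x. poly p x = 0} = degree p"
proof -
  have p0: "p \<noteq> 0" using assms(2) by auto
  have pos: "0 < r i" if "i \<in> {1..degree p}" for i
    using assms(1) that unfolding alternating_roots_def
    by (cases "i = 1") (auto intro: less_trans[of 0 "r 1"])
  have abs: "\<bar>\<zeta> i\<bar> = r i" if "i \<in> {1..degree p}" for i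
    using pos[OF that] by (simp add: \<zeta>_def abs_mult)
  have inj: "inj_on \<zeta> {1..degree p}"
  proof (rule inj_onI)
    fix i j assume ij: "i \<in> {1..degree p}" "j \<in> {1..degree p}" "\<zeta> i = \<zeta> j"
    then have "r i = r j" using abs by metis
    then show "i = j"
      using assms(1) ij(1,2) unfolding alternating_roots_def
      by (metis atLeastAtMost_iff less_irrefl linorder_neqE_nat)
  qed
  have sub: "\<zeta> ` {1..degree p} \<subseteq> {x. poly p x = 0}"
    using assms(1) by (auto simp: alternating_roots_def \<zeta>_def)
  have c: "card (\<zeta> ` {1..degree p}) = degree p"
    using inj by (simp add: card_image)
  then have "\<zeta> ` {1..degree p} = {x. poly p x = 0}"
    using card_poly_roots_bound[OF p0] sub by (intro card_seteq poly_roots_finite p0) auto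
  with inj c show "bij_betw \<zeta> {1..degree p} {x. poly p x = 0}" "card {x. poly p x = 0} = degree p"
    by (auto simp: bij_betw_def)
qed

lemma self_interlacing_iff_alternating_roots:
  assumes "degree p \<ge> 1"
  shows "self_interlacing_I p \<longleftrightarrow> (\<exists>r. alternating_roots p r)"
proof
  assume "self_interlacing_I p"
  then obtain \<zeta> :: "nat \<Rightarrow> real" where \<zeta>: "bij_betw \<zeta> {1..degree p} {x. poly p x = 0}" "0 < \<zeta> 1"
      "\<And>i. 1 \<le> i \<Longrightarrow> i < degree p \<Longrightarrow> (-1) ^ (i - 1) * \<zeta> i < (-1) ^ i * \<zeta> (i + 1)"
    unfolding self_interlacing_I_def by blast
  define r where "r i = (-1) ^ (i - 1) * \<zeta> i" for i
  have "poly p ((-1) ^ (i - 1) * r i) = 0" if "1 \<le> i" "i \<le> degree p" for i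
    using bij_betwE[OF \<zeta>(1)] that by (simp add: r_def flip: mult.assoc power_add mult_2)
  moreover have "r i < r j" if "1 \<le> i" "i < j" "j \<le> degree p" for i j
    by (rule increasing_if_step[OF _ that]) (use \<zeta>(3) in \<open>simp add: r_def\<close>)
  ultimately show "\<exists>r. alternating_roots p r"
    using \<zeta>(2) by (intro exI[of _ r]) (auto simp: alternating_roots_def r_def)
next
  assume "\<exists>r. alternating_roots p r"
  then obtain r where r: "alternating_roots p r" ..
  define \<zeta> where "\<zeta> i = (-1) ^ (i - 1) * r i" for i
  have p0: "p \<noteq> 0" using assms by auto
  have split: "bij_betw \<zeta> {1..degree p} {x. poly p x = 0}" "card {x. poly p x = 0} = degree p"
    using alternating_roots_all[OF r assms] by (simp_all add: \<zeta>_def[abs_def])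
  have "z \<in> \<real> \<and> order z (cpoly p) = 1" if "poly (cpoly p) z = 0" for z
  proof
    have "z \<in> {z. poly (cpoly p) z = 0}"
      using that by simp
    then show "z \<in> \<real>"
      unfolding cpoly_roots_split(1)[OF p0 split(2)] by auto
    show "order z (cpoly p) = 1"
      using cpoly_roots_split(2)[OF p0 split(2)] that p0
      by (intro order_eq_1_if_split) (auto simp: cpoly_eq_0_iff)
  qed
  moreover have "(-1) ^ (i - 1) * \<zeta> i < (-1) ^ i * \<zeta> (i + 1)" if "1 \<le> i" "i < degree p" for i
    using r that by (simp add: alternating_roots_def \<zeta>_def flip: mult.assoc power_add mult_2)
  moreover have "0 < \<zeta> 1"
    using r by (simp add: alternating_roots_def \<zeta>_def)
  ultimately show "self_interlacing_I p"
    using split(1) unfolding self_interlacing_I_def by blast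
qed

section \<open>From positive residues to alternating roots\<close>

text \<open>Each term \<open>\<beta> / (u - w)\<close> with \<open>\<beta> > 0\<close> decreases on either side of \<open>w\<close>.\<close>

lemma quotient_antimono_between_poles:
  assumes AB: "positive_residues A B" and "u \<le> v"
    and gap: "\<And>w. poly B w = 0 \<Longrightarrow> w < u \<or> v < w"
  shows "poly A v / poly B v \<le> poly A u / poly B u"
proof -
  have B: "B \<noteq> 0" "card {x. poly B x = 0} = degree B" "degree A \<le> degree B"
    using AB by (auto simp: positive_residues_def)
  have "poly A w / poly (pderiv B) w / (v - w) \<le> poly A w / poly (pderiv B) w / (u - w)"
    if "poly B w = 0" for w
    using positive_residues_coeff_pos[OF AB that] gap[OF that] \<open>u \<le> v\<close>
    by (intro divide_left_mono) (auto simp: mult_pos_pos mult_neg_neg)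
  then have sum_le: "(\<Sum>w | poly B w = 0. poly A w / poly (pderiv B) w / (v - w)) \<le>
      (\<Sum>w | poly B w = 0. poly A w / poly (pderiv B) w / (u - w))"
    by (intro sum_mono) blast
  have "poly B u \<noteq> 0" "poly B v \<noteq> 0"
    using gap \<open>u \<le> v\<close> by force+
  show ?thesis
    unfolding partial_fractions[OF B \<open>poly B u \<noteq> 0\<close>] partial_fractions[OF B \<open>poly B v \<noteq> 0\<close>]
    using sum_le by (rule add_left_mono)
qed

lemma root_to_the_right:
  fixes p :: "real poly"
  assumes "0 < lead_coeff p" "poly p a < 0"
  obtains x where "a < x" "poly p x = 0"
proof -
  obtain N where N: "\<And>x. x \<ge> N \<Longrightarrow> poly p x \<ge> lead_coeff p"
    using poly_pinfty_gt_lc[OF assms(1)] by blast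
  have "\<exists>x. a < x \<and> x < max N (a + 1) \<and> poly p x = 0"
    using assms N[of "max N (a + 1)"] by (intro poly_IVT_pos) auto
  then show ?thesis using that by blast
qed

text \<open>At \<open>- \<infinity>\<close> the polynomial has the sign of \<open>(-1)^(deg p)\<close>; reflecting it reduces the claim to the
  behaviour at \<open>+ \<infinity>\<close>.\<close>

lemma root_to_the_left:
  fixes p :: "real poly"
  assumes "0 < lead_coeff p" "(-1) ^ degree p * poly p (- a) < 0"
  obtains x where "a < x" "poly p (- x) = 0"
proof -
  define q where "q = smult ((-1) ^ degree p) (pcompose p [:0, -1:])"
  have q: "poly q x = (-1) ^ degree p * poly p (- x)" for x
    by (simp add: q_def poly_pcompose)
  have "lead_coeff q = (-1) ^ degree p * (lead_coeff p * (-1) ^ degree p)"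
    by (simp add: q_def lead_coeff_comp)
  also have "\<dots> = lead_coeff p"
    by (simp add: minus_one_power_iff)
  finally have "0 < lead_coeff q" "poly q a < 0"
    using assms q by simp_all
  then obtain x where "a < x" "poly q x = 0"
    by (rule root_to_the_right)
  then show ?thesis using that q by simp
qed

text \<open>The square roots of the roots of \<open>B\<close>, together with \<open>0\<close>, cut the half-line into \<open>l + 1\<close>
  gaps. Gap number \<open>k\<close> contains the absolute value \<open>y k\<close> of a negative root (for \<open>k \<ge> 1\<close>) and a
  positive root \<open>x k\<close> (for \<open>k < l\<close>, and for \<open>k = l\<close> if the degree is odd), which makes
  \<open>n\<close> roots in all. Inside a gap \<open>y k\<close> precedes \<open>x k\<close> by the monotonicity of \<open>A / B\<close>.\<close>

lemma alternating_roots_if_positive_residues: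
  fixes p :: "real poly"
  defines "A \<equiv> odd_part p" and "B \<equiv> even_part p"
  assumes p: "degree p \<ge> 1" "0 < lead_coeff p"
    and AB: "positive_residues A B" "degree B = degree p div 2"
    and lead: "0 < (-1) ^ degree p * lead_coeff B"
  shows "\<exists>r. alternating_roots p r"
proof -
  define n where "n = degree p"
  define l where "l = n div 2"
  have B: "B \<noteq> 0" "card {x. poly B x = 0} = l" "degree B = l"
    using AB by (auto simp: positive_residues_def l_def n_def)
  have p_eq: "poly p x = poly B (x\<^sup>2) + x * poly A (x\<^sup>2)" for x
    unfolding A_def B_def by (rule even_odd_decomposition)
  obtain \<omega> where \<omega>: "{x. poly B x = 0} = \<omega> ` {1..l}"
      "\<And>i j. 1 \<le> i \<Longrightarrow> i < j \<Longrightarrow> j \<le> l \<Longrightarrow> \<omega> i < \<omega> j"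
    using finite_set_increasing_enum[OF poly_roots_finite[OF B(1)]] B(2) by metis
  have \<omega>_root: "poly B (\<omega> k) = 0" if "1 \<le> k" "k \<le> l" for k
    using that \<omega>(1) by auto
  have \<omega>_pos: "0 < \<omega> k" if "1 \<le> k" "k \<le> l" for k
    using \<omega>_root[OF that] AB(1) by (auto simp: positive_residues_def)
  define b where "b k = (if k = 0 then 0 else sqrt (\<omega> k))" for k :: nat
  have b_sq: "(b k)\<^sup>2 = \<omega> k" if "1 \<le> k" "k \<le> l" for k
    using \<omega>_pos[OF that] that by (simp add: b_def)
  have b_less: "b i < b j" if "i < j" "j \<le> l" for i j
    using that \<omega>(2)[of i j] \<omega>_pos[of j] by (auto simp: b_def)
  have b_nonneg: "0 \<le> b k" if "k \<le> l" for k
    using b_less[of 0 k] that by (cases "k = 0") (auto simp: b_def)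

  \<comment> \<open>The exponent is \<open>n + l - k\<close> up to parity: \<open>B\<close> has the sign \<open>(-1)^n\<close> at infinity and \<open>l - k\<close> roots above \<open>\<omega> k\<close>.\<close>
  have sign_A: "0 < (-1) ^ (n + l + k) * poly A (\<omega> k)" if k: "1 \<le> k" "k \<le> l" for k
  proof -
    have "{w. poly B w = 0 \<and> \<omega> k < w} = {w \<in> {w. poly B w = 0}. \<omega> k < w}"
      by blast
    then have "card {w. poly B w = 0 \<and> \<omega> k < w} = l - k"
      using card_above_increasing_enum[of l \<omega> k] \<omega> k by simp
    then have "0 < lead_coeff B * (-1) ^ (l - k) * poly (pderiv B) (\<omega> k)"
      using pderiv_sign[OF B(1) _ \<omega>_root[OF k]] B by simp
    moreover have "0 < poly A (\<omega> k) * poly (pderiv B) (\<omega> k)"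
      using AB(1) \<omega>_root[OF k] by (auto simp: positive_residues_def)
    ultimately show ?thesis
      using lead k by (auto simp: n_def minus_one_power_iff zero_less_mult_iff mult_less_0_iff split: if_splits)
  qed
  have sign_pos: "0 < (-1) ^ (n + l + k) * poly p (b k)" if "k \<le> l" for k
  proof (cases "k = 0")
    case True
    have "0 < lead_coeff B * (-1) ^ card {w. poly B w = 0 \<and> 0 < w} * poly B 0"
      using B AB(1) by (intro poly_sign) (auto simp: positive_residues_def)
    moreover have "{w. poly B w = 0 \<and> 0 < w} = {w. poly B w = 0}"
      using AB(1) by (auto simp: positive_residues_def)
    ultimately show ?thesis
      using lead B True
      by (auto simp: p_eq b_def n_def minus_one_power_iff zero_less_mult_iff mult_less_0_iff split: if_splits)
  next
    case False
    then have "poly p (b k) = b k * poly A (\<omega> k)" "0 < b k"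
      using that \<omega>_root[of k] b_less[of 0 k] by (auto simp: p_eq b_sq b_def)
    then show ?thesis
      using sign_A[of k] False that by (simp add: zero_less_mult_iff mult_less_0_iff mult.left_commute)
  qed
  have sign_neg: "(-1) ^ (n + l + k) * poly p (- b k) < 0" if "1 \<le> k" "k \<le> l" for k
  proof -
    have "poly p (- b k) = - (b k * poly A (\<omega> k))" "0 < b k"
      using that \<omega>_root[of k] b_less[of 0 k] by (auto simp: p_eq b_sq b_def)
    then show ?thesis
      using sign_A[of k] that by (simp add: zero_less_mult_iff mult_less_0_iff mult.left_commute)
  qed

  \<comment> \<open>The last gap, number \<open>l\<close>, is unbounded.\<close>
  define gap where "gap k z \<longleftrightarrow> b k < z \<and> (k < l \<longrightarrow> z < b (k + 1))" for k z
  have gap_root: "w < u\<^sup>2 \<or> v\<^sup>2 < w" if h: "gap k u" "gap k v" "k \<le> l" "poly B w = 0" for k u v w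
  proof -
    have "w \<in> \<omega> ` {1..l}"
      using h(4) unfolding \<omega>(1)[symmetric] by simp
    then obtain j where j: "w = \<omega> j" "1 \<le> j" "j \<le> l"
      by auto
    have "0 < u" "0 < v" using h(1-3) b_nonneg[of k] by (auto simp: gap_def)
    show ?thesis
    proof (cases "j \<le> k")
      case True
      then have "b j < u"
        using h(1,3) b_less[of j k] by (cases "j = k") (auto simp: gap_def)
      then show ?thesis
        using power_strict_mono[of "b j" u 2] b_nonneg[of j] j b_sq[of j] by simp
    next
      case False
      then have "v < b j"
        using h(2) j b_less[of "k + 1" j] by (cases "j = k + 1") (auto simp: gap_def)
      then show ?thesis
        using power_strict_mono[of v "b j" 2] \<open>0 < v\<close> j b_sq[of j] by simp
    qed
  qed

  \<comment> \<open>In the last gap \<open>p\<close> is negative at \<open>b l\<close> when \<open>n\<close> is odd, but eventually positive.\<close>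
  have "\<exists>x. gap k x \<and> poly p x = 0" if "2 * k + 1 \<le> n" for k
  proof (cases "k < l")
    case True
    then have "poly p (b k) * poly p (b (k + 1)) < 0"
      using sign_pos[of k] sign_pos[of "k + 1"]
      by (auto simp: minus_one_power_iff mult_less_0_iff split: if_splits)
    then show ?thesis
      using poly_IVT[OF b_less[of k "k + 1"]] True by (auto simp: gap_def)
  next
    case False
    then have "k = l" "odd n" using that by (auto simp: l_def)
    then have "poly p (b l) < 0"
      using sign_pos[of l] by (auto simp: minus_one_power_iff)
    then show ?thesis
      using root_to_the_right[OF p(2), of "b l"] \<open>k = l\<close> by (auto simp: gap_def)
  qed
  then obtain x where x: "\<And>k. 2 * k + 1 \<le> n \<Longrightarrow> gap k (x k)" "\<And>k. 2 * k + 1 \<le> n \<Longrightarrow> poly p (x k) = 0"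
    by metis
  \<comment> \<open>For even \<open>n\<close> the last gap contains only this root, and it comes from the sign of \<open>p\<close> at \<open>- \<infinity>\<close>.\<close>
  have "\<exists>y. gap k y \<and> poly p (- y) = 0" if "1 \<le> k" "2 * k \<le> n" for k
  proof (cases "k < l")
    case True
    then have "poly p (- b (k + 1)) * poly p (- b k) < 0"
      using sign_neg[of k] sign_neg[of "k + 1"] that
      by (auto simp: minus_one_power_iff mult_less_0_iff split: if_splits)
    then obtain z where "- b (k + 1) < z" "z < - b k" "poly p z = 0"
      using poly_IVT[of "- b (k + 1)" "- b k"] b_less[of k "k + 1"] True by auto
    then show ?thesis
      using True by (intro exI[of _ "- z"]) (auto simp: gap_def)
  next
    case False
    then have "k = l" using that by (auto simp: l_def)
    then have "(-1) ^ degree p * poly p (- b l) < 0"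
      using sign_neg[of l] that by (auto simp: minus_one_power_iff n_def split: if_splits)
    then show ?thesis
      using root_to_the_left[OF p(2), of "b l"] \<open>k = l\<close> by (auto simp: gap_def)
  qed
  then obtain y where y: "\<And>k. 1 \<le> k \<Longrightarrow> 2 * k \<le> n \<Longrightarrow> gap k (y k)"
      "\<And>k. 1 \<le> k \<Longrightarrow> 2 * k \<le> n \<Longrightarrow> poly p (- y k) = 0"
    by metis

  have y_less_x: "y k < x k" if k: "1 \<le> k" "2 * k + 1 \<le> n" for k
  proof (rule ccontr)
    assume "\<not> y k < x k"
    have kl: "k \<le> l" using k by (simp add: l_def)
    have g: "gap k (x k)" "gap k (y k)" using x(1) y(1) k by auto
    then have pos: "0 < x k" "0 < y k" using b_nonneg[OF kl] by (auto simp: gap_def)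
    have nz: "poly B ((x k)\<^sup>2) \<noteq> 0" "poly B ((y k)\<^sup>2) \<noteq> 0"
      using gap_root[OF g(1) g(1) kl] gap_root[OF g(2) g(2) kl] by auto
    have "(x k)\<^sup>2 \<le> (y k)\<^sup>2"
      using \<open>\<not> y k < x k\<close> pos by (intro power_mono) auto
    then have "poly A ((y k)\<^sup>2) / poly B ((y k)\<^sup>2) \<le> poly A ((x k)\<^sup>2) / poly B ((x k)\<^sup>2)"
      using gap_root[OF g kl] by (intro quotient_antimono_between_poles[OF AB(1)])
    moreover have "poly A ((x k)\<^sup>2) / poly B ((x k)\<^sup>2) = - (1 / x k)"
      using x(2)[OF k(2)] p_eq[of "x k"] pos nz by (simp add: field_simps)
    moreover have "poly A ((y k)\<^sup>2) / poly B ((y k)\<^sup>2) = 1 / y k"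
      using y(2)[of k] k p_eq[of "- y k"] pos nz by (simp add: field_simps)
    ultimately have "1 / y k \<le> - (1 / x k)" by simp
    moreover have "0 < 1 / y k" "0 < 1 / x k" using pos by auto
    ultimately show False by linarith
  qed

  \<comment> \<open>The order is \<open>x 0 < y 1 < x 1 < y 2 < x 2 < \<dots>\<close>.\<close>
  define r where "r m = (if even m then y (m div 2) else x (m div 2))" for m
  have "r m < r (m + 1)" if "1 \<le> m" "m < n" for m
  proof (cases "even m")
    case True
    then show ?thesis using y_less_x[of "m div 2"] that by (auto simp: r_def elim!: evenE)
  next
    case False
    then obtain k where k: "m = 2 * k + 1" by (auto elim: oddE)
    then have "x k < b (k + 1)" "b (k + 1) < y (k + 1)"
      using x(1)[of k] y(1)[of "k + 1"] that by (auto simp: gap_def l_def)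
    then show ?thesis by (simp add: r_def k)
  qed
  then have "r i < r j" if "1 \<le> i" "i < j" "j \<le> n" for i j
    using increasing_if_step[of n r i j] that by blast
  moreover have "0 < r 1"
    using x(1)[of 0] p(1) by (simp add: r_def gap_def b_def n_def)
  moreover have "poly p ((-1) ^ (m - 1) * r m) = 0" if "1 \<le> m" "m \<le> n" for m
    using x(2)[of "m div 2"] y(2)[of "m div 2"] that
    by (cases "even m") (auto simp: r_def minus_one_power_iff elim!: evenE oddE)
  ultimately show ?thesis
    by (intro exI[of _ r]) (auto simp: alternating_roots_def n_def)
qed

section \<open>From alternating roots to positive residues\<close>

text \<open>The positive roots are the \<open>r i\<close> with \<open>i\<close> odd, the negative ones are the \<open>- r i\<close> with \<open>i\<close> even.
  Counting the roots to the right of a point yields the sign of \<open>p\<close> at all points \<open>x \<ge> 0\<close>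
  other than the positive roots (\<open>sign_pos\<close>) and at \<open>- r (2 k - 1)\<close> (\<open>sign_neg\<close>). These signs differ
  for \<open>r (2 k)\<close> and \<open>- r (2 k - 1)\<close>, so that \<open>B\<close> has a root between the squares of these numbers.\<close>

lemma positive_residues_if_alternating_roots:
  fixes p :: "real poly"
  defines "A \<equiv> odd_part p" and "B \<equiv> even_part p"
  assumes p: "degree p \<ge> 1" "0 < lead_coeff p" and r: "alternating_roots p r"
  shows "positive_residues A B" "degree B = degree p div 2" "0 < (-1) ^ degree p * lead_coeff B"
proof -
  define n where "n = degree p"
  define l where "l = n div 2"
  \<comment> \<open>There are \<open>m\<close> positive and \<open>l\<close> negative roots.\<close>
  define m where "m = n - l"
  have m: "m = (n + 1) div 2" "l \<le> m" "n = l + m" by (auto simp: m_def l_def)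
  have le_l_iff: "j \<le> l \<longleftrightarrow> 2 * j \<le> n" for j
    by (auto simp: l_def)
  have less_m_iff: "j < m \<longleftrightarrow> 2 * j + 1 \<le> n" for j
    using m(1) by auto
  have p0: "p \<noteq> 0" using p by auto
  have p_eq: "poly p x = poly B (x\<^sup>2) + x * poly A (x\<^sup>2)" for x
    unfolding A_def B_def by (rule even_odd_decomposition)
  define \<zeta> where "\<zeta> i = (-1) ^ (i - 1) * r i" for i
  have roots: "{x. poly p x = 0} = \<zeta> ` {1..n}" "card {x. poly p x = 0} = n"
    using alternating_roots_all[OF r p(1)] by (simp_all add: \<zeta>_def[abs_def] bij_betw_def n_def)
  have r_less: "r i < r j" if "1 \<le> i" "i < j" "j \<le> n" for i j
    using r that by (auto simp: alternating_roots_def n_def)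
  have r_pos: "0 < r i" if "1 \<le> i" "i \<le> n" for i
    using r r_less[of 1 i] that by (cases "i = 1") (auto simp: alternating_roots_def)
  have root_iff: "poly p x = 0 \<longleftrightarrow> (\<exists>j<m. x = r (2 * j + 1)) \<or> (\<exists>j\<in>{1..l}. x = - r (2 * j))" for x
  proof -
    have "poly p x = 0 \<longleftrightarrow> (\<exists>i\<in>{1..n}. x = \<zeta> i)"
      using roots(1) by auto
    also have "\<dots> \<longleftrightarrow> (\<exists>i\<in>{1..n}. odd i \<and> x = r i) \<or> (\<exists>i\<in>{1..n}. even i \<and> x = - r i)"
      by (auto simp: \<zeta>_def minus_one_power_iff)
    also have "(\<exists>i\<in>{1..n}. odd i \<and> x = r i) \<longleftrightarrow> (\<exists>j<m. x = r (2 * j + 1))"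
    proof
      show "\<exists>j<m. x = r (2 * j + 1)" if "\<exists>i\<in>{1..n}. odd i \<and> x = r i"
        using that less_m_iff by (auto elim!: oddE)
      show "\<exists>i\<in>{1..n}. odd i \<and> x = r i" if "\<exists>j<m. x = r (2 * j + 1)"
      proof -
        from that obtain j where "j < m" "x = r (2 * j + 1)" by blast
        then show ?thesis using less_m_iff[of j] by (intro bexI[of _ "2 * j + 1"]) auto
      qed
    qed
    also have "(\<exists>i\<in>{1..n}. even i \<and> x = - r i) \<longleftrightarrow> (\<exists>j\<in>{1..l}. x = - r (2 * j))"
    proof
      show "\<exists>j\<in>{1..l}. x = - r (2 * j)" if "\<exists>i\<in>{1..n}. even i \<and> x = - r i"
      proof -
        from that obtain j where "2 * j \<in> {1..n}" "x = - r (2 * j)" by (auto elim!: evenE)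
        then show ?thesis by (intro bexI[of _ j]) (auto simp: l_def)
      qed
      show "\<exists>i\<in>{1..n}. even i \<and> x = - r i" if "\<exists>j\<in>{1..l}. x = - r (2 * j)"
      proof -
        from that obtain j where "j \<in> {1..l}" "x = - r (2 * j)" by blast
        then show ?thesis by (intro bexI[of _ "2 * j"]) (auto simp: l_def)
      qed
    qed
    finally show ?thesis .
  qed
  have sign: "0 < (-1) ^ card {w. poly p w = 0 \<and> x < w} * poly p x" if "poly p x \<noteq> 0" for x
    using poly_sign[OF p0 _ that] roots(2) p(2) by (simp add: n_def zero_less_mult_iff mult.assoc)
  have inj_odd: "inj_on (\<lambda>j. r (2 * j + 1)) {..<m}"
  proof (rule linorder_inj_onI)
    show "r (2 * i + 1) \<noteq> r (2 * j + 1)" if "i < j" "i \<in> {..<m}" "j \<in> {..<m}" for i j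
      using r_less[of "2 * i + 1" "2 * j + 1"] less_m_iff[of j] that by simp
  qed auto
  have inj_even: "inj_on (\<lambda>j. - r (2 * j)) {1..l}"
  proof (rule linorder_inj_onI)
    show "- r (2 * i) \<noteq> - r (2 * j)" if "i < j" "i \<in> {1..l}" "j \<in> {1..l}" for i j
    proof -
      have "2 * j \<le> n" using that by (auto simp: l_def)
      then show ?thesis using r_less[of "2 * i" "2 * j"] that by simp
    qed
  qed auto

  \<comment> \<open>To the right of \<open>x\<close> lie all positive roots but the first \<open>k\<close>.\<close>
  have sign_pos: "0 < (-1) ^ (m + k) * poly p x"
    if k: "k \<le> l" and x: "0 \<le> x" "1 \<le> k \<Longrightarrow> r (2 * k - 1) < x" "2 * k + 1 \<le> n \<Longrightarrow> x < r (2 * k + 1)"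
    for k x
  proof -
    have odd_iff: "x < r (2 * j + 1) \<longleftrightarrow> k \<le> j" and odd_ne: "x \<noteq> r (2 * j + 1)" if "j < m" for j
    proof -
      have j: "2 * j + 1 \<le> n" using that less_m_iff by auto
      have "r (2 * j + 1) < x" if "j < k"
      proof (cases "j + 1 = k")
        case True
        then show ?thesis using x(2) by auto
      next
        case False
        have "2 * k - 1 \<le> n" using k by (auto simp: l_def)
        then have "r (2 * j + 1) < r (2 * k - 1)"
          using False that by (intro r_less) auto
        then show ?thesis using x(2) that by linarith
      qed
      moreover have "x < r (2 * j + 1)" if "k \<le> j"
        using x(3) r_less[of "2 * k + 1" "2 * j + 1"] that j by (cases "j = k") auto
      ultimately show "x < r (2 * j + 1) \<longleftrightarrow> k \<le> j" "x \<noteq> r (2 * j + 1)"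
        by (cases "j < k"; force)+
    qed
    have even_less: "- r (2 * j) < x" if "j \<in> {1..l}" for j
      using r_pos[of "2 * j"] that x(1) by (auto simp: le_l_iff)
    have "{w. poly p w = 0 \<and> x < w} = (\<lambda>j. r (2 * j + 1)) ` {k..<m}"
    proof (intro set_eqI iffI)
      fix w assume "w \<in> {w. poly p w = 0 \<and> x < w}"
      then have w: "poly p w = 0" "x < w" by auto
      from w(1) consider j where "j < m" "w = r (2 * j + 1)" | j where "j \<in> {1..l}" "w = - r (2 * j)"
        using root_iff by blast
      then show "w \<in> (\<lambda>j. r (2 * j + 1)) ` {k..<m}"
      proof cases
        case (1 j)
        then show ?thesis using odd_iff[of j] w(2) by auto
      next
        case (2 j)
        then show ?thesis using even_less[of j] w(2) by auto
      qed
    next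
      fix w assume "w \<in> (\<lambda>j. r (2 * j + 1)) ` {k..<m}"
      then obtain j where "k \<le> j" "j < m" "w = r (2 * j + 1)" by auto
      then show "w \<in> {w. poly p w = 0 \<and> x < w}"
        using odd_iff[of j] root_iff[of w] by auto
    qed
    also have "card \<dots> = m - k"
    proof (subst card_image)
      show "inj_on (\<lambda>j. r (2 * j + 1)) {k..<m}"
        by (rule inj_on_subset[OF inj_odd]) auto
    qed simp
    finally have "card {w. poly p w = 0 \<and> x < w} = m - k" .
    moreover have "poly p x \<noteq> 0"
    proof
      assume "poly p x = 0"
      then consider j where "j < m" "x = r (2 * j + 1)" | j where "j \<in> {1..l}" "x = - r (2 * j)"
        using root_iff by blast
      then show False
      proof cases
        case (1 j)
        then show ?thesis using odd_ne[of j] by auto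
      next
        case (2 j)
        then show ?thesis using even_less[of j] by auto
      qed
    qed
    ultimately show ?thesis
      using sign[of x] k m(2) by (simp add: minus_one_power_iff)
  qed
  \<comment> \<open>To the right of \<open>- r (2 k - 1)\<close> lie all positive and the first \<open>k - 1\<close> negative roots.\<close>
  have sign_neg: "(-1) ^ (m + k) * poly p (- r (2 * k - 1)) < 0" if k: "1 \<le> k" "k \<le> l" for k
  proof -
    let ?x = "- r (2 * k - 1)"
    have kn: "2 * k \<le> n" using k by (auto simp: l_def)
    have odd_gt: "?x < r (2 * j + 1)" if "j < m" for j
    proof -
      have "0 < r (2 * j + 1)" using that less_m_iff[of j] by (intro r_pos) auto
      moreover have "0 < r (2 * k - 1)" using k kn by (intro r_pos) auto
      ultimately show ?thesis by linarith
    qed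
    have even_iff: "?x < - r (2 * j) \<longleftrightarrow> j < k" and even_ne: "?x \<noteq> - r (2 * j)" if "j \<in> {1..l}" for j
    proof -
      have j: "2 * j \<le> n" "1 \<le> j" using that by (auto simp: le_l_iff)
      have "?x < - r (2 * j)" if "j < k"
        using r_less[of "2 * j" "2 * k - 1"] that j kn by linarith
      moreover have "- r (2 * j) < ?x" if "k \<le> j"
        using r_less[of "2 * k - 1" "2 * j"] that j k by linarith
      ultimately show "?x < - r (2 * j) \<longleftrightarrow> j < k" "?x \<noteq> - r (2 * j)"
        by (cases "j < k"; force)+
    qed
    have "{w. poly p w = 0 \<and> ?x < w} =
        (\<lambda>j. r (2 * j + 1)) ` {..<m} \<union> (\<lambda>j. - r (2 * j)) ` {1..<k}"
    proof (intro set_eqI iffI)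
      fix w assume "w \<in> {w. poly p w = 0 \<and> ?x < w}"
      then have w: "poly p w = 0" "?x < w" by auto
      from w(1) consider j where "j < m" "w = r (2 * j + 1)" | j where "j \<in> {1..l}" "w = - r (2 * j)"
        using root_iff by blast
      then show "w \<in> (\<lambda>j. r (2 * j + 1)) ` {..<m} \<union> (\<lambda>j. - r (2 * j)) ` {1..<k}"
      proof cases
        case (1 j)
        then show ?thesis by auto
      next
        case (2 j)
        then show ?thesis using even_iff[of j] w(2) by auto
      qed
    next
      fix w assume "w \<in> (\<lambda>j. r (2 * j + 1)) ` {..<m} \<union> (\<lambda>j. - r (2 * j)) ` {1..<k}"
      then consider j where "j < m" "w = r (2 * j + 1)" | j where "j \<in> {1..<k}" "w = - r (2 * j)"
        by blast
      then show "w \<in> {w. poly p w = 0 \<and> ?x < w}"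
      proof cases
        case (1 j)
        then show ?thesis using odd_gt[of j] root_iff[of w] by auto
      next
        case (2 j)
        then have "j \<in> {1..l}" "j < k" using k by auto
        then have "?x < - r (2 * j)" "poly p (- r (2 * j)) = 0"
          using even_iff[of j] root_iff[of "- r (2 * j)"] by blast+
        then show ?thesis using 2 by simp
      qed
    qed
    also have "card \<dots> = card ((\<lambda>j. r (2 * j + 1)) ` {..<m}) + card ((\<lambda>j. - r (2 * j)) ` {1..<k})"
    proof (rule card_Un_disjoint)
      have "0 < r (2 * j + 1)" if "j < m" for j
        using r_pos[of "2 * j + 1"] that less_m_iff[of j] by simp
      moreover have "- r (2 * j) < 0" if "j \<in> {1..<k}" for j
        using r_pos[of "2 * j"] that kn by simp
      ultimately show "(\<lambda>j. r (2 * j + 1)) ` {..<m} \<inter> (\<lambda>j. - r (2 * j)) ` {1..<k} = {}"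
        by force
    qed auto
    also have "\<dots> = m + (k - 1)"
    proof -
      have "inj_on (\<lambda>j. - r (2 * j)) {1..<k}"
        by (rule inj_on_subset[OF inj_even]) (use k in auto)
      then show ?thesis
        using card_image[OF inj_odd] card_image[of "\<lambda>j. - r (2 * j)" "{1..<k}"] by simp
    qed
    finally have "card {w. poly p w = 0 \<and> ?x < w} = m + (k - 1)" .
    moreover have "poly p ?x \<noteq> 0"
    proof
      assume "poly p ?x = 0"
      then consider j where "j < m" "?x = r (2 * j + 1)" | j where "j \<in> {1..l}" "?x = - r (2 * j)"
        using root_iff by blast
      then show False
      proof cases
        case (1 j)
        then show ?thesis using odd_gt[of j] by auto
      next
        case (2 j)
        then show ?thesis using even_ne[of j] by blast
      qed
    qed
    ultimately show ?thesis
      using sign[of ?x] k by (auto simp: minus_one_power_iff split: if_splits)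
  qed

  have "\<exists>w. (r (2 * k - 1))\<^sup>2 < w \<and> w < (r (2 * k))\<^sup>2 \<and> poly B w = 0" if k: "1 \<le> k" "k \<le> l" for k
  proof (rule poly_IVT)
    have kn: "2 * k \<le> n" using k by (auto simp: l_def)
    have less: "r (2 * k - 1) < r (2 * k)" "0 < r (2 * k - 1)"
      using r_less[of "2 * k - 1" "2 * k"] r_pos[of "2 * k - 1"] k kn by auto
    then show "(r (2 * k - 1))\<^sup>2 < (r (2 * k))\<^sup>2"
      by (intro power_strict_mono) auto
    have "2 * k - 1 = 2 * (k - 1) + 1" "k - 1 < m" "k \<in> {1..l}"
      using k m(2) by auto
    then have zero: "poly p (r (2 * k - 1)) = 0" "poly p (- r (2 * k)) = 0"
      using root_iff by metis+
    have "poly B ((r (2 * k - 1))\<^sup>2) = poly p (- r (2 * k - 1)) / 2"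
      "poly B ((r (2 * k))\<^sup>2) = poly p (r (2 * k)) / 2"
      using zero p_eq[of "r (2 * k - 1)"] p_eq[of "- r (2 * k - 1)"] p_eq[of "r (2 * k)"] p_eq[of "- r (2 * k)"]
      by auto
    moreover have "0 < (-1) ^ (m + k) * poly p (r (2 * k))"
      using less k kn r_less[of "2 * k" "2 * k + 1"] by (intro sign_pos) auto
    ultimately show "poly B ((r (2 * k - 1))\<^sup>2) * poly B ((r (2 * k))\<^sup>2) < 0"
      using sign_neg[OF k] by (auto simp: minus_one_power_iff mult_less_0_iff split: if_splits)
  qed
  then obtain \<omega> where \<omega>: "\<And>k. 1 \<le> k \<Longrightarrow> k \<le> l \<Longrightarrow> (r (2 * k - 1))\<^sup>2 < \<omega> k"
      "\<And>k. 1 \<le> k \<Longrightarrow> k \<le> l \<Longrightarrow> \<omega> k < (r (2 * k))\<^sup>2" "\<And>k. 1 \<le> k \<Longrightarrow> k \<le> l \<Longrightarrow> poly B (\<omega> k) = 0"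
    by metis
  have \<omega>_less: "\<omega> i < \<omega> j" if "1 \<le> i" "i < j" "j \<le> l" for i j
  proof -
    have "(r (2 * i))\<^sup>2 < (r (2 * j - 1))\<^sup>2"
      using r_less[of "2 * i" "2 * j - 1"] r_pos[of "2 * i"] that
      by (intro power_strict_mono) (auto simp: le_l_iff)
    then show ?thesis using \<omega>(2)[of i] \<omega>(1)[of j] that by auto
  qed
  have inj_\<omega>: "inj_on \<omega> {1..l}"
  proof (intro linorder_inj_onI)
    show "\<omega> i \<noteq> \<omega> j" if "i < j" "i \<in> {1..l}" "j \<in> {1..l}" for i j
      using \<omega>_less[of i j] that by simp
  qed auto

  \<comment> \<open>The value \<open>B 0 = p 0\<close> fixes the sign of the leading coefficient, because all roots of \<open>B\<close> are positive.\<close>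
  have "0 < (-1) ^ (m + 0) * poly p 0"
    using r_pos[of 1] p(1) by (intro sign_pos) (auto simp: n_def)
  then have B_0: "0 < (-1) ^ m * poly B 0"
    by (simp add: p_eq)
  then have B0: "B \<noteq> 0" by auto
  have deg_le: "degree B \<le> l" "degree A \<le> l"
    using degree_even_part[of p] degree_odd_part[of p] by (auto simp: A_def B_def l_def n_def)
  have card_\<omega>: "card (\<omega> ` {1..l}) = l"
    using inj_\<omega> by (simp add: card_image)
  have B_roots: "\<omega> ` {1..l} = {x. poly B x = 0}"
    using card_poly_roots_bound[OF B0] deg_le \<omega>(3) card_\<omega>
    by (intro card_seteq poly_roots_finite B0) auto
  then have split: "card {x. poly B x = 0} = degree B" and deg: "degree B = l"
    using card_poly_roots_bound[OF B0] deg_le card_\<omega> by auto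
  have \<omega>_pos: "0 < \<omega> k" if "1 \<le> k" "k \<le> l" for k
    using \<omega>(1)[OF that] zero_le_power2[of "r (2 * k - 1)"] by linarith

  have "0 < w" if "poly B w = 0" for w
  proof -
    have "w \<in> \<omega> ` {1..l}" using that unfolding B_roots by simp
    then show ?thesis using \<omega>_pos by auto
  qed
  then have "{w. poly B w = 0 \<and> 0 < w} = {w. poly B w = 0}"
    by blast
  then have "0 < lead_coeff B * (-1) ^ l * poly B 0"
    using poly_sign[OF B0 split, of 0] B_0 deg split by auto
  then have lead: "0 < (-1) ^ n * lead_coeff B"
    using B_0 m(3) by (auto simp: minus_one_power_iff zero_less_mult_iff mult_less_0_iff split: if_splits)

  have "0 < w \<and> 0 < poly A w * poly (pderiv B) w" if "poly B w = 0" for w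
  proof -
    have "w \<in> \<omega> ` {1..l}"
      using that unfolding B_roots by simp
    then obtain k where k: "w = \<omega> k" "1 \<le> k" "k \<le> l"
      by auto
    have kn: "2 * k \<le> n" using k by (auto simp: l_def)
    have rk: "0 < r (2 * k - 1)" "0 < r (2 * k)" using r_pos k kn by auto
    \<comment> \<open>As \<open>p s = s A w\<close>, the sign of \<open>A\<close> at \<open>w\<close> is that of \<open>p\<close> at \<open>s\<close>.\<close>
    define s where "s = sqrt w"
    have s: "s\<^sup>2 = w" "0 < s" using \<omega>_pos[of k] k by (auto simp: s_def)
    have "r (2 * k - 1) < s" "s < r (2 * k)"
      using \<omega>(1,2)[of k] k rk s by (auto intro: power2_less_imp_less)
    then have "0 < (-1) ^ (m + k) * poly p s"
      using r_less[of "2 * k" "2 * k + 1"] k s by (intro sign_pos) auto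
    then have sign_A: "0 < (-1) ^ (m + k) * poly A w"
      using that s by (simp add: p_eq zero_less_mult_iff mult_less_0_iff)
    have "{v. poly B v = 0 \<and> w < v} = {v \<in> \<omega> ` {1..l}. \<omega> k < v}"
      unfolding B_roots k(1) by blast
    then have "card {v. poly B v = 0 \<and> w < v} = l - k"
      using card_above_increasing_enum[of l \<omega> k] \<omega>_less k by simp
    then have "0 < lead_coeff B * (-1) ^ (l - k) * poly (pderiv B) w"
      using pderiv_sign[OF B0 split that] by simp
    then show ?thesis
      using sign_A lead k \<omega>_pos[of k] m(3)
      by (auto simp: minus_one_power_iff zero_less_mult_iff mult_less_0_iff split: if_splits)
  qed
  then show "positive_residues A B"
    using B0 split deg deg_le by (auto simp: positive_residues_def)
  show "degree B = degree p div 2" "0 < (-1) ^ degree p * lead_coeff B"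
    using deg lead by (auto simp: l_def n_def)
qed

section \<open>The characterization by the associated function\<close>

lemma self_interlacing_iff_positive_residues:
  assumes "degree p \<ge> 1" "0 < lead_coeff p"
  shows "self_interlacing_I p \<longleftrightarrow>
    positive_residues (odd_part p) (even_part p) \<and> degree (even_part p) = degree p div 2 \<and>
    0 < (-1) ^ degree p * lead_coeff (even_part p)"
  unfolding self_interlacing_iff_alternating_roots[OF assms(1)]
  using alternating_roots_if_positive_residues[OF assms] positive_residues_if_alternating_roots[OF assms]
  by blast

lemma associated_function_eq: "associated_function p = quotient_function (odd_part p) (even_part p)"
  by (simp add: associated_function_def)

lemma not_is_pole_const: "\<not> is_pole (\<lambda>_. c :: complex) (u :: complex)"
  using not_tendsto_and_filterlim_at_infinity[OF at_neq_bot tendsto_const] by (auto simp: is_pole_def)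

lemma rational_function_associated_function:
  assumes "even_part p \<noteq> 0"
  shows "rational_function (associated_function p)"
  unfolding rational_function_def associated_function_def
  using assms by (intro exI[of _ "cpoly (odd_part p)"] exI[of _ "cpoly (even_part p)"])
    (auto simp: cpoly_eq_0_iff)

theorem theorem4p3:
  fixes p :: "real poly" and n l :: nat
  assumes "degree p = n" and "n \<ge> 1" and "lead_coeff p > 0" and "l = n div 2"
  shows "self_interlacing_I p \<longleftrightarrow>
    R_function_or_constant (associated_function p) \<and>
    finite {u. is_pole (associated_function p) u} \<and>
    card {u. is_pole (associated_function p) u} = l \<and>
    (\<forall>u. is_pole (associated_function p) u \<longrightarrow> u \<in> \<real> \<and> Re u > 0) \<and>
    (n = 2 * l + 1 \<longrightarrow>
      (\<exists>L::real. L < 0 \<and>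
        ((\<lambda>x::real. associated_function p (of_real x)) \<longlongrightarrow> of_real L) at_top \<and>
        ((\<lambda>x::real. associated_function p (of_real x)) \<longlongrightarrow> of_real L) at_bot))"
    (is "_ \<longleftrightarrow> ?R \<and> _ \<and> ?card \<and> ?pos \<and> (?odd \<longrightarrow> ?lim)")
proof -
  define A where "A = odd_part p"
  define B where "B = even_part p"
  have \<Phi>: "associated_function p = quotient_function A B"
    by (simp add: A_def B_def associated_function_eq)
  have deg_le: "degree A \<le> l" "degree B \<le> l"
    using degree_odd_part[of p] degree_even_part[of p] assms(1,4) by (simp_all add: A_def B_def)
  have top_coeff: "coeff A l = lead_coeff p" if ?odd
    using that assms(1) by (simp add: A_def coeff_odd_part)
  have iff: "self_interlacing_I p \<longleftrightarrow>
      positive_residues A B \<and> degree B = l \<and> 0 < (-1) ^ n * lead_coeff B"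
    using self_interlacing_iff_positive_residues[of p] assms by (simp add: A_def B_def)
  show ?thesis
    unfolding iff
  proof (intro iffI conjI; (elim conjE)?)
    assume AB: "positive_residues A B" and deg: "degree B = l" and lead: "0 < (-1) ^ n * lead_coeff B"
    have B: "B \<noteq> 0" "card {x. poly B x = 0} = degree B"
      using AB by (auto simp: positive_residues_def)
    have poles: "{u. is_pole (associated_function p) u} = of_real ` {w. poly B w = 0}"
      unfolding \<Phi> by (rule quotient_function_poles[OF AB])
    show ?R
    proof (cases "l = 0")
      case True
      then have no_roots: "{w. poly B w = 0} = {}"
        using B deg poly_roots_finite[OF B(1)] by simp
      then have "{u. poly (cpoly B) u = 0} = {}"
        using cpoly_roots_split(1)[OF B] by simp
      then have "associated_function p u = of_real (coeff A (degree B) / lead_coeff B)" for u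
        unfolding \<Phi> using no_roots by (subst quotient_function_partial_fractions[OF AB]) auto
      then show ?thesis
        unfolding R_function_or_constant_def by blast
    next
      case False
      then have "R_function (associated_function p)"
        using rational_function_associated_function[of p] quotient_function_Im_neg[OF AB] B(1) deg
        by (auto simp: R_function_def \<Phi> B_def)
      then show ?thesis
        by (simp add: R_function_or_constant_def)
    qed
    show "finite {u. is_pole (associated_function p) u}"
      unfolding poles using poly_roots_finite[OF B(1)] by (rule finite_imageI)
    show ?card
      unfolding poles using B(2) deg by (subst card_image) (auto intro: inj_onI)
    show ?pos
    proof (intro allI impI)
      fix u assume "is_pole (associated_function p) u"
      then have "u \<in> of_real ` {w. poly B w = 0}"
        unfolding poles[symmetric] by simp
      then show "u \<in> \<real> \<and> Re u > 0"
        using AB by (auto simp: positive_residues_def)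
    qed
    show "?odd \<longrightarrow> ?lim"
    proof
      assume ?odd
      then have "coeff A (degree B) / lead_coeff B < 0"
        using top_coeff deg lead assms(3) by (auto simp: divide_less_0_iff)
      moreover have "((\<lambda>x. associated_function p (of_real x)) \<longlongrightarrow>
          of_real (coeff A (degree B) / lead_coeff B)) F" if "F \<le> at_infinity" for F :: "real filter"
        unfolding \<Phi> using quotient_function_limit[OF AB] that by (rule tendsto_mono[rotated])
      ultimately show ?lim
        using at_top_le_at_infinity at_bot_le_at_infinity by blast
    qed
  next
    assume R: ?R and card: ?card and pos: ?pos and lim: "?odd \<longrightarrow> ?lim"
    \<comment> \<open>Division by \<open>0\<close> would make the function vanish identically, which leaves only \<open>n = 1\<close> and then contradicts the negative limit.\<close>
    have B0: "B \<noteq> 0"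
    proof
      assume "B = 0"
      then have zero: "associated_function p = (\<lambda>_. 0)"
        by (auto simp: \<Phi> fun_eq_iff)
      then have "l = 0"
        using card by (simp add: not_is_pole_const)
      then have "n = 2 * l + 1" using assms(2,4) by auto
      then obtain L :: real where "L < 0" "((\<lambda>x::real. 0) \<longlongrightarrow> complex_of_real L) at_top"
        using lim unfolding zero by blast
      then show False
        by (simp add: tendsto_const_iff)
    qed
    have "card {u. is_pole (associated_function p) u} \<le> card {u. poly (cpoly B) u = 0}"
      unfolding \<Phi> using B0
      by (intro card_mono poly_roots_finite) (auto simp: cpoly_eq_0_iff dest: pole_imp_root)
    also have "\<dots> \<le> degree B"
      using card_poly_roots_bound[of "cpoly B"] B0 by (simp add: cpoly_eq_0_iff degree_cpoly)
    finally have deg: "degree B = l"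
      using card deg_le by simp
    show AB: "positive_residues A B"
    proof (rule positive_residues_if_R_function[OF B0])
      show "degree A \<le> degree B" using deg deg_le by simp
      show "card {u. is_pole (quotient_function A B) u} = degree B"
        using card deg by (simp add: \<Phi>)
      show "u \<in> \<real> \<and> Re u > 0" if "is_pole (quotient_function A B) u" for u
        using pos that by (simp add: \<Phi>)
      show "Im (quotient_function A B z) < 0" if "Im z > 0" "degree B > 0" for z
      proof -
        \<comment> \<open>A constant has no poles, whereas the degree of \<open>B\<close> is their number.\<close>
        have "\<nexists>c::real. associated_function p = (\<lambda>_. of_real c)"
        proof
          assume "\<exists>c::real. associated_function p = (\<lambda>_. of_real c)"
          then have "l = 0"
            using card by (auto simp: not_is_pole_const)
          then show False using that deg by simp
        qed
        then show ?thesis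
          using R that by (simp add: R_function_or_constant_def R_function_def \<Phi>)
      qed
    qed
    show "degree B = l" by (rule deg)
    show "0 < (-1) ^ n * lead_coeff B"
    proof (cases "even n")
      case True
      then have "lead_coeff B = lead_coeff p"
        using deg assms(1,4) by (simp add: B_def coeff_even_part)
      then show ?thesis using True assms(3) by simp
    next
      case False
      then have odd: ?odd using assms(4) by auto
      then obtain L :: real where L: "L < 0"
          "((\<lambda>x. associated_function p (of_real x)) \<longlongrightarrow> of_real L) at_top"
        using lim by blast
      have "((\<lambda>x. associated_function p (of_real x)) \<longlongrightarrow>
          of_real (coeff A (degree B) / lead_coeff B)) at_top"
        unfolding \<Phi> using quotient_function_limit[OF AB] at_top_le_at_infinity
        by (rule tendsto_mono[rotated])
      then have "of_real (coeff A (degree B) / lead_coeff B) = complex_of_real L"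
        using L(2) by (rule tendsto_unique[OF trivial_limit_at_top_linorder])
      then have "lead_coeff p / lead_coeff B = L"
        using top_coeff[OF odd] deg by (simp only: of_real_eq_iff)
      then have "lead_coeff B < 0"
        using L(1) assms(3) by (metis divide_less_0_iff not_less_iff_gr_or_eq)
      then show ?thesis using False by simp
    qed
  qed
qed

end
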